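(* Let $G$ be a connected cubic bipartite graph. Then $ak(G)=4$.
   Context: Graphs are finite and simple. A graph is cubic if every vertex has degree $3$. A perfect matching of a graph is a set of pairwise non-adjacent edges that covers all vertices. For a connected graph $G$, an edge set $S\subseteq E(G)$ is called an anti-Kekulé set if $G-S$ is connected and has no perfect matching, where $G-S$ denotes the subgraph obtained from $G$ by deleting all edges in $S$ (all vertices are kept; $S$ may be empty). The anti-Kekulé number $ak(G)$ is the cardinality of a smallest anti-Kekulé set of $G$. *)

theory Defs
  imports Main "HOL-Library.Extended_Nat"
begin

text \<open>
  A graph is given by its vertex set \<open>V\<close> and its edge set \<open>E\<close>; edges are two-element sets of
  vertices, so a finite simple graph has neither loops nor parallel edges, and an undirected edge
  counts once in the cardinality of an edge set.
\<close>

definition simple_graph :: "'a set \<Rightarrow> 'a set set \<Rightarrow> bool" where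
  "simple_graph V E \<longleftrightarrow> finite V \<and> (\<forall>e\<in>E. e \<subseteq> V \<and> card e = 2)"

definition degree :: "'a set set \<Rightarrow> 'a \<Rightarrow> nat" where
  "degree E v = card {e \<in> E. v \<in> e}"

definition cubic :: "'a set \<Rightarrow> 'a set set \<Rightarrow> bool" where
  "cubic V E \<longleftrightarrow> (\<forall>v\<in>V. degree E v = 3)"

definition bipartite :: "'a set \<Rightarrow> 'a set set \<Rightarrow> bool" where
  "bipartite V E \<longleftrightarrow>
     (\<exists>A B. A \<union> B = V \<and> A \<inter> B = {} \<and> (\<forall>e\<in>E. \<exists>a\<in>A. \<exists>b\<in>B. e = {a, b}))"

text \<open>The graph without vertices is not connected.\<close>

definition graph_connected :: "'a set \<Rightarrow> 'a set set \<Rightarrow> bool" where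
  "graph_connected V E \<longleftrightarrow>
     V \<noteq> {} \<and> (\<forall>u\<in>V. \<forall>v\<in>V. (u, v) \<in> {(x, y). {x, y} \<in> E}\<^sup>*)"

definition perfect_matching :: "'a set \<Rightarrow> 'a set set \<Rightarrow> 'a set set \<Rightarrow> bool" where
  "perfect_matching V E M \<longleftrightarrow> M \<subseteq> E \<and> pairwise disjnt M \<and> \<Union>M = V"

definition anti_kekule_set :: "'a set \<Rightarrow> 'a set set \<Rightarrow> 'a set set \<Rightarrow> bool" where
  "anti_kekule_set V E S \<longleftrightarrow>
     S \<subseteq> E \<and> graph_connected V (E - S) \<and> \<not> (\<exists>M. perfect_matching V (E - S) M)"

text \<open>
  The value is \<open>\<infinity>\<close> if there is no anti-Kekule set, so a finite value includes the existence of a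
  smallest one.
\<close>

definition anti_kekule_number :: "'a set \<Rightarrow> 'a set set \<Rightarrow> enat" where
  "anti_kekule_number V E = (INF S\<in>{S. anti_kekule_set V E S}. enat (card S))"

end

theory Submission
  imports Defs
begin

text \<open>
  Lower bound. Suppose at most three edges are deleted, and the rest has no perfect matching. The
  two colour classes have equal size, so by Hall's marriage theorem there are a set \<open>X\<close> in one
  class and the set \<open>Y\<close> of its remaining neighbours with \<open>|Y| < |X|\<close>. The \<open>3|X|\<close> edges at \<open>X\<close>
  lose at most three, and those that remain are among the \<open>3|Y| \<le> 3|X| - 3\<close> edges at \<open>Y\<close>. Hence
  all these inequalities are equalities: the remaining edges at \<open>X\<close> are exactly the edges at \<open>Y\<close>,
  so \<open>X \<union> Y\<close> is cut off from the other vertices and the remaining graph is not connected. This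
  is \<open>perfect_matching_after_deleting_three\<close>.

  Upper bound. Take two neighbours \<open>p\<close>, \<open>q\<close> of a vertex \<open>a\<close> and delete the four edges that join
  them to vertices other than \<open>a\<close>. Now \<open>p\<close> and \<open>q\<close> are leaves at \<open>a\<close>, so they cannot both be
  matched. The remaining graph is connected as soon as the graph without \<open>p\<close> and \<open>q\<close> is. That
  such \<open>a\<close>, \<open>p\<close>, \<open>q\<close> exist is \<open>nonseparating_neighbours\<close>, which holds in every finite connected
  graph of minimum degree at least three: a choice whose removal leaves a largest possible
  connected piece leaves nothing outside that piece.
\<close>

section \<open>Hall's marriage theorem\<close>

text \<open>
  Rado's argument: if some \<open>N a\<close> contains two elements, one of them can be removed from it without
  violating Hall's condition. Otherwise both removals are obstructed, by sets \<open>X\<close> and \<open>Y\<close> say, and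
  counting neighbours of \<open>insert a (X \<union> Y)\<close> and of \<open>X \<inter> Y\<close> contradicts the condition. Once every
  \<open>N a\<close> is a singleton, the condition for two-element sets says that these singletons differ.
\<close>

lemma hall_marriage:
  fixes N :: "'a \<Rightarrow> 'b set"
  assumes "finite A" and "\<forall>a\<in>A. finite (N a)"
    and "\<forall>X\<subseteq>A. card X \<le> card (\<Union>(N ` X))"
  shows "\<exists>f. inj_on f A \<and> (\<forall>a\<in>A. f a \<in> N a)"
  using assms(2,3)
proof (induction "\<Sum>a\<in>A. card (N a)" arbitrary: N rule: less_induct)
  case less
  have fin: "finite (\<Union>(N ` X))" if "X \<subseteq> A" for X
    using that less.prems(1) finite_subset[OF that \<open>finite A\<close>] by auto
  show ?case
  proof (cases "\<exists>a\<in>A. 2 \<le> card (N a)")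
    case False
    have "card (N a) = 1" if "a \<in> A" for a
    proof -
      have "1 \<le> card (N a)" using less.prems(2)[rule_format, of "{a}"] that by simp
      then show ?thesis using False that by force
    qed
    then have "\<forall>a\<in>A. \<exists>b. N a = {b}" by (simp add: card_1_singleton_iff)
    then obtain f where f: "\<forall>a\<in>A. N a = {f a}" by metis
    have "inj_on f A"
    proof (rule inj_onI, rule ccontr)
      fix x y assume xy: "x \<in> A" "y \<in> A" "f x = f y" "x \<noteq> y"
      then have "card {x, y} \<le> card (\<Union>(N ` {x, y}))"
        by (intro less.prems(2)[rule_format]) auto
      then show False using xy f by simp
    qed
    then show ?thesis using f by auto
  next
    case True
    then obtain a where a: "a \<in> A" "2 \<le> card (N a)" by blast
    then obtain T where "T \<subseteq> N a" "card T = 2"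
      by (meson obtain_subset_with_card_n)
    then obtain x y where xy: "x \<in> N a" "y \<in> N a" "x \<noteq> y" by (auto simp: card_2_iff)
    define N' where "N' z = N(a := N a - {z})" for z
    have sub: "N' z b \<subseteq> N b" for z b by (simp add: N'_def)
    have obstruction: "\<exists>X. X \<subseteq> A - {a} \<and> card (\<Union>(N ` X) \<union> (N a - {z})) \<le> card X"
      if z: "z \<in> N a" and no: "\<not> (\<exists>f. inj_on f A \<and> (\<forall>a\<in>A. f a \<in> N a))" for z
    proof -
      have "(\<Sum>b\<in>A. card (N' z b)) < (\<Sum>b\<in>A. card (N b))"
      proof (rule sum_strict_mono_ex1[OF \<open>finite A\<close>])
        show "\<forall>b\<in>A. card (N' z b) \<le> card (N b)"
          using less.prems(1) sub by (blast intro: card_mono)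
        have "card (N a - {z}) < card (N a)"
          using z less.prems(1) a by (intro card_Diff1_less) auto
        then show "\<exists>b\<in>A. card (N' z b) < card (N b)"
          using a by (intro bexI[of _ a]) (auto simp: N'_def)
      qed
      moreover have "\<forall>b\<in>A. finite (N' z b)"
        using less.prems(1) sub by (meson finite_subset)
      moreover have "\<not> (\<exists>f. inj_on f A \<and> (\<forall>b\<in>A. f b \<in> N' z b))"
        using no sub by blast
      ultimately obtain W where W: "W \<subseteq> A" "card (\<Union>(N' z ` W)) < card W"
        using less.hyps[of "N' z"] by (meson linorder_not_le)
      have "a \<in> W"
      proof (rule ccontr)
        assume "a \<notin> W"
        then have "\<Union>(N' z ` W) = \<Union>(N ` W)" by (auto simp: N'_def)
        then show False using W less.prems(2) by (metis linorder_not_le)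
      qed
      have "\<Union>(N' z ` W) = \<Union>(N ` (W - {a})) \<union> (N a - {z})"
        using \<open>a \<in> W\<close> by (auto simp: N'_def)
      moreover have "card W = Suc (card (W - {a}))"
        using \<open>a \<in> W\<close> finite_subset[OF W(1) \<open>finite A\<close>] by (metis card_Suc_Diff1)
      ultimately show ?thesis
        using W by (intro exI[of _ "W - {a}"]) auto
    qed
    show ?thesis
    proof (rule ccontr)
      assume no: "\<not> ?thesis"
      obtain X where X: "X \<subseteq> A - {a}" "card (\<Union>(N ` X) \<union> (N a - {x})) \<le> card X"
        using obstruction[OF xy(1) no] by blast
      obtain Y where Y: "Y \<subseteq> A - {a}" "card (\<Union>(N ` Y) \<union> (N a - {y})) \<le> card Y"
        using obstruction[OF xy(2) no] by blast
      let ?P = "\<Union>(N ` X) \<union> (N a - {x})" and ?Q = "\<Union>(N ` Y) \<union> (N a - {y})"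
      have fX: "finite X" "finite Y" using X Y \<open>finite A\<close> by (auto intro: finite_subset)
      have fP: "finite ?P" "finite ?Q"
        using fin[of X] fin[of Y] X Y a less.prems(1) by auto
      have "card (insert a (X \<union> Y)) \<le> card (\<Union>(N ` insert a (X \<union> Y)))"
        using X Y a by (intro less.prems(2)[rule_format]) auto
      also have "\<Union>(N ` insert a (X \<union> Y)) = ?P \<union> ?Q" using xy by auto
      finally have 1: "Suc (card (X \<union> Y)) \<le> card (?P \<union> ?Q)"
        using X Y fX by (simp add: subset_Diff_insert)
      have "card (X \<inter> Y) \<le> card (\<Union>(N ` (X \<inter> Y)))"
        using X by (intro less.prems(2)[rule_format]) auto
      also have "\<dots> \<le> card (?P \<inter> ?Q)" using fP by (intro card_mono) auto
      finally have 2: "card (X \<inter> Y) \<le> card (?P \<inter> ?Q)" .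
      have "card (?P \<union> ?Q) + card (?P \<inter> ?Q) \<le> card X + card Y"
        using X Y card_Un_Int[OF fP] by linarith
      also have "\<dots> = card (X \<union> Y) + card (X \<inter> Y)" using card_Un_Int[OF fX] .
      finally show False using 1 2 by linarith
    qed
  qed
qed

section \<open>Connectedness and degrees\<close>

lemma graph_connectedI:
  assumes "c \<in> V" and "\<And>v. v \<in> V \<Longrightarrow> (v, c) \<in> {(x, y). {x, y} \<in> E}\<^sup>*"
  shows "graph_connected V E"
proof -
  have "sym {(x, y). {x, y} \<in> E}" by (auto simp: sym_def insert_commute)
  then have "sym ({(x, y). {x, y} \<in> E}\<^sup>*)" by (rule sym_rtrancl)
  then have "(c, v) \<in> {(x, y). {x, y} \<in> E}\<^sup>*" if "v \<in> V" for v
    using assms(2)[OF that] by (rule symD)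
  then show ?thesis
    using assms unfolding graph_connected_def by (blast intro: rtrancl_trans)
qed

lemma graph_connected_edge_leaving:
  assumes "graph_connected V E" and "W \<subseteq> V" and "W \<noteq> {}" and "W \<noteq> V"
  shows "\<exists>x y. {x, y} \<in> E \<and> x \<in> W \<and> y \<notin> W"
proof (rule ccontr)
  assume closed: "\<not> ?thesis"
  obtain w v where wv: "w \<in> W" "v \<in> V" "v \<notin> W" using assms by blast
  have "(w, v) \<in> {(x, y). {x, y} \<in> E}\<^sup>*"
    using assms wv unfolding graph_connected_def by blast
  then have "v \<in> W" using wv(1) closed by induction auto
  then show False using wv by blast
qed

lemma graph_connected_insert:
  assumes "graph_connected C {e \<in> E. e \<subseteq> C}" and "c \<in> C" and "{b, c} \<in> E"
  shows "graph_connected (insert b C) {e \<in> E. e \<subseteq> insert b C}"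
proof (rule graph_connectedI[of c])
  let ?R = "{(x, y). {x, y} \<in> {e \<in> E. e \<subseteq> insert b C}}"
  show "c \<in> insert b C" using assms by simp
  fix v assume "v \<in> insert b C"
  moreover have "(v, c) \<in> ?R\<^sup>*" if "v \<in> C"
  proof -
    have "(v, c) \<in> {(x, y). {x, y} \<in> {e \<in> E. e \<subseteq> C}}\<^sup>*"
      using assms that unfolding graph_connected_def by blast
    then show ?thesis by (rule rtrancl_mono[THEN subsetD, rotated]) auto
  qed
  moreover have "(b, c) \<in> ?R\<^sup>*" using assms by auto
  ultimately show "(v, c) \<in> ?R\<^sup>*" by blast
qed

lemma finite_edges: "simple_graph V E \<Longrightarrow> finite E"
  unfolding simple_graph_def by (meson PowI finite_Pow_iff finite_subset subsetI)

lemma simple_graph_edgeD: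
  assumes "simple_graph V E" and "{x, y} \<in> E"
  shows "x \<in> V" and "y \<in> V" and "x \<noteq> y"
proof -
  have "{x, y} \<subseteq> V" "card {x, y} = 2" using assms unfolding simple_graph_def by blast+
  then show "x \<in> V" "y \<in> V" "x \<noteq> y" by auto
qed

lemma bipartition_edge:
  assumes "A \<inter> B = {}" and "\<forall>e\<in>E. \<exists>a\<in>A. \<exists>b\<in>B. e = {a, b}" and "{x, y} \<in> E"
  shows "x \<in> A \<longleftrightarrow> y \<notin> A"
proof -
  obtain a b where ab: "a \<in> A" "b \<in> B" "{x, y} = {a, b}" using assms(2,3) by blast
  then have "b \<notin> A" using assms(1) by blast
  then show ?thesis using ab by (auto simp: doubleton_eq_iff)
qed

lemma degree_eq_card_neighbours:
  assumes "simple_graph V E"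
  shows "degree E v = card {w. {v, w} \<in> E}"
proof -
  have "{e \<in> E. v \<in> e} = (\<lambda>w. {v, w}) ` {w. {v, w} \<in> E}"
  proof (intro equalityI subsetI)
    fix e assume e: "e \<in> {e \<in> E. v \<in> e}"
    then obtain x y where "e = {x, y}" using assms unfolding simple_graph_def by (auto simp: card_2_iff)
    then show "e \<in> (\<lambda>w. {v, w}) ` {w. {v, w} \<in> E}" using e by (auto simp: insert_commute)
  qed auto
  moreover have "inj_on (\<lambda>w. {v, w}) {w. {v, w} \<in> E}" by (auto simp: inj_on_def doubleton_eq_iff)
  ultimately show ?thesis unfolding degree_def by (simp add: card_image)
qed

lemma card_edges_meeting:
  assumes "finite X" and "finite E"
    and "\<And>e x y. e \<in> E \<Longrightarrow> x \<in> e \<inter> X \<Longrightarrow> y \<in> e \<inter> X \<Longrightarrow> x = y"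
    and "\<And>x. x \<in> X \<Longrightarrow> degree E x = d"
  shows "card {e \<in> E. e \<inter> X \<noteq> {}} = d * card X"
proof -
  have "{e \<in> E. e \<inter> X \<noteq> {}} = (\<Union>x\<in>X. {e \<in> E. x \<in> e})" by auto
  also have "card \<dots> = (\<Sum>x\<in>X. card {e \<in> E. x \<in> e})"
    using assms by (intro card_UN_disjoint) auto
  also have "\<dots> = (\<Sum>x\<in>X. d)"
    using assms(4) by (intro sum.cong) (auto simp: degree_def)
  finally show ?thesis by simp
qed

section \<open>Deleting at most three edges\<close>

lemma perfect_matching_after_deleting_three:
  assumes "simple_graph V E" and "cubic V E" and "bipartite V E"
    and "S \<subseteq> E" and "card S \<le> 3" and conn: "graph_connected V (E - S)"
  shows "\<exists>M. perfect_matching V (E - S) M"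
proof -
  obtain A B where AB: "A \<union> B = V" "A \<inter> B = {}" "\<forall>e\<in>E. \<exists>a\<in>A. \<exists>b\<in>B. e = {a, b}"
    using assms(3) unfolding bipartite_def by blast
  have finV: "finite A" "finite B" using assms(1) AB(1) unfolding simple_graph_def by auto
  have finE: "finite E" using finite_edges assms(1) .
  define inc where "inc X = {e \<in> E. e \<inter> X \<noteq> {}}" for X
  have card_inc: "card (inc X) = 3 * card X" if "X \<subseteq> A \<or> X \<subseteq> B" for X
    unfolding inc_def
  proof (rule card_edges_meeting[OF _ finE])
    show "finite X" using that finV finite_subset by blast
    show "degree E x = 3" if "x \<in> X" for x
      using \<open>X \<subseteq> A \<or> X \<subseteq> B\<close> that AB(1) assms(2) unfolding cubic_def by blast
    show "x = y" if e: "e \<in> E" and "x \<in> e \<inter> X" "y \<in> e \<inter> X" for e x y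
    proof -
      obtain a b where ab: "a \<in> A" "b \<in> B" "e = {a, b}" using AB(3) e by blast
      moreover have "a \<notin> B" "b \<notin> A" using ab AB(2) by auto
      ultimately show ?thesis using that(2,3) \<open>X \<subseteq> A \<or> X \<subseteq> B\<close> by auto
    qed
  qed
  have "inc A = E" "inc B = E" using AB(3) unfolding inc_def by fastforce+
  then have cardAB: "card A = card B" using card_inc[of A] card_inc[of B] by simp
  define N where "N a = {b. {a, b} \<in> E - S}" for a
  have NB: "N a \<subseteq> B" if "a \<in> A" for a
  proof
    fix b assume "b \<in> N a"
    then obtain a' b' where "a' \<in> A" "b' \<in> B" "{a, b} = {a', b'}"
      using AB(3) unfolding N_def by fastforce
    then show "b \<in> B" using AB(2) that by (auto simp: doubleton_eq_iff)
  qed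
  have "\<forall>X\<subseteq>A. card X \<le> card (\<Union>(N ` X))"
  proof (intro allI impI, rule ccontr)
    fix X assume X: "X \<subseteq> A" and "\<not> card X \<le> card (\<Union>(N ` X))"
    define Y where "Y = \<Union>(N ` X)"
    have less: "card Y < card X" using \<open>\<not> _\<close> Y_def by simp
    have YB: "Y \<subseteq> B" using NB X unfolding Y_def by blast
    have sub: "inc X - S \<subseteq> inc Y"
    proof
      fix e assume e: "e \<in> inc X - S"
      then obtain a b where ab: "a \<in> A" "b \<in> B" "e = {a, b}" using AB(3) unfolding inc_def by blast
      then have "a \<in> X" using e X AB(2) unfolding inc_def by blast
      then have "b \<in> Y" using e ab unfolding Y_def N_def inc_def by blast
      then show "e \<in> inc Y" using e ab unfolding inc_def by blast
    qed
    have finS: "finite S" using assms(4) finE finite_subset by blast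
    have "card (inc Y) \<le> card (inc X - S)"
      using diff_card_le_card_Diff[OF finS, of "inc X"] card_inc[of X] card_inc[of Y] X YB less assms(5)
      by linarith
    moreover have "finite (inc Y)" using finE unfolding inc_def by simp
    ultimately have eq: "inc X - S = inc Y" using sub by (metis card_seteq)
    \<comment> \<open>No remaining edge leaves \<open>X \<union> Y\<close>, and this set is a proper part of the graph.\<close>
    have "X \<union> Y \<noteq> V"
    proof
      assume "X \<union> Y = V"
      then have "X = A" "Y = B" using X YB AB(1,2) by blast+
      then show False using cardAB less by simp
    qed
    moreover have "X \<union> Y \<subseteq> V" "X \<union> Y \<noteq> {}" using X YB AB(1) less by auto
    ultimately obtain x y where xy: "{x, y} \<in> E - S" "x \<in> X \<union> Y" "y \<notin> X \<union> Y"
      using graph_connected_edge_leaving[OF conn] by blast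
    then have "{x, y} \<in> inc X - S" using eq unfolding inc_def by blast
    then have "{x, y} \<inter> X \<noteq> {}" "{x, y} \<inter> Y \<noteq> {}" using eq unfolding inc_def by blast+
    then show False using xy X YB AB(2) by blast
  qed
  then obtain f where f: "inj_on f A" "\<forall>a\<in>A. f a \<in> N a"
    using hall_marriage[of A N] finV NB finite_subset by metis
  have fB: "f ` A = B"
    using f NB finV cardAB by (intro card_subset_eq) (auto simp: card_image)
  have "perfect_matching V (E - S) ((\<lambda>a. {a, f a}) ` A)"
    unfolding perfect_matching_def
  proof (intro conjI)
    show "(\<lambda>a. {a, f a}) ` A \<subseteq> E - S" using f(2) unfolding N_def by auto
    show "\<Union>((\<lambda>a. {a, f a}) ` A) = V" using fB AB(1) by auto
    have "a \<noteq> f a'" if "a \<in> A" "a' \<in> A" for a a' using that fB AB(2) by blast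
    then have "disjnt {a, f a} {a', f a'}" if "a \<in> A" "a' \<in> A" "{a, f a} \<noteq> {a', f a'}" for a a'
      using that inj_onD[OF f(1)] by (force simp: disjnt_def)
    then show "pairwise disjnt ((\<lambda>a. {a, f a}) ` A)" by (auto simp: pairwise_def)
  qed
  then show ?thesis by blast
qed

section \<open>Two neighbours that do not separate the graph\<close>

text \<open>
  Among all choices of \<open>a\<close>, \<open>p\<close>, \<open>q\<close> and a connected set \<open>C\<close> avoiding \<open>p\<close> and \<open>q\<close>, take one with
  \<open>C\<close> largest, and let \<open>D\<close> be the set of the remaining vertices; no edge joins \<open>C\<close> and \<open>D\<close>. If
  \<open>D\<close> is nonempty, then one of \<open>p\<close>, \<open>q\<close>, say \<open>r\<close>, has neighbours in both \<open>C\<close> and \<open>D\<close>: both sets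
  have a neighbour among \<open>p\<close>, \<open>q\<close>, and one of them contains the common neighbour \<open>a\<close>. Let \<open>d\<close> be
  a neighbour of \<open>r\<close> in \<open>D\<close>. Two further neighbours of \<open>d\<close> lie outside the connected set
  \<open>insert r C\<close>, so that \<open>d\<close>, these two and \<open>insert r C\<close> are a better choice.
\<close>

lemma nonseparating_neighbours:
  assumes G: "simple_graph V E" and conn: "graph_connected V E"
    and deg: "\<And>v. v \<in> V \<Longrightarrow> 3 \<le> degree E v"
  obtains a p q where "{a, p} \<in> E" and "{a, q} \<in> E" and "p \<noteq> q"
    and "graph_connected (V - {p, q}) {e \<in> E. e \<subseteq> V - {p, q}}"
proof -
  have two_more: "\<exists>p q. {v, p} \<in> E \<and> {v, q} \<in> E \<and> p \<noteq> q \<and> p \<noteq> r \<and> q \<noteq> r" if "v \<in> V" for v r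
  proof -
    have "3 \<le> card {w. {v, w} \<in> E}" using deg[OF that] degree_eq_card_neighbours[OF G] by metis
    then have "2 \<le> card ({w. {v, w} \<in> E} - {r})"
      using diff_card_le_card_Diff[of "{r}" "{w. {v, w} \<in> E}"] by simp
    then obtain T where "T \<subseteq> {w. {v, w} \<in> E} - {r}" "card T = 2"
      by (meson obtain_subset_with_card_n)
    then show ?thesis by (auto simp: card_2_iff)
  qed
  have finV: "finite V" using G unfolding simple_graph_def by simp
  define good where "good C \<longleftrightarrow> C \<subseteq> V \<and> graph_connected C {e \<in> E. e \<subseteq> C} \<and>
    (\<exists>a p q. {a, p} \<in> E \<and> {a, q} \<in> E \<and> p \<noteq> q \<and> p \<notin> C \<and> q \<notin> C)" for C
  obtain v where v: "v \<in> V" using conn unfolding graph_connected_def by blast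
  have "graph_connected {v} {e \<in> E. e \<subseteq> {v}}" by (rule graph_connectedI[of v]) auto
  moreover have "\<exists>a p q. {a, p} \<in> E \<and> {a, q} \<in> E \<and> p \<noteq> q \<and> p \<notin> {v} \<and> q \<notin> {v}"
    using two_more[OF v, of v] by blast
  ultimately have "good {v}" using v unfolding good_def by simp
  moreover have "\<forall>C. good C \<longrightarrow> card C < Suc (card V)"
    using finV unfolding good_def by (simp add: card_mono less_Suc_eq_le)
  ultimately obtain C where C: "good C" and max: "\<And>C'. good C' \<Longrightarrow> card C' \<le> card C"
    using ex_has_greatest_nat[of good "{v}" card] by blast
  have no_larger: "\<not> good (insert r C)" if "r \<notin> C" for r
  proof
    assume "good (insert r C)"
    then have "card (insert r C) \<le> card C" by (rule max)
    moreover have "finite C" using C finV finite_subset unfolding good_def by blast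
    ultimately show False using that by simp
  qed
  obtain a p q where apq: "{a, p} \<in> E" "{a, q} \<in> E" "p \<noteq> q" "p \<notin> C" "q \<notin> C"
    using C unfolding good_def by blast
  have CV: "C \<subseteq> V" and Cc: "graph_connected C {e \<in> E. e \<subseteq> C}" and "C \<noteq> {}"
    using C unfolding good_def graph_connected_def by auto
  have pqV: "a \<in> V" "p \<in> V" "q \<in> V" "a \<noteq> p" "a \<noteq> q"
    using simple_graph_edgeD[OF G apq(1)] simple_graph_edgeD[OF G apq(2)] by auto
  define D where "D = V - {p, q} - C"
  have no_edge: "{x, y} \<notin> E" if "x \<in> D" "y \<in> C" for x y
  proof
    assume "{x, y} \<in> E"
    then have "graph_connected (insert x C) {e \<in> E. e \<subseteq> insert x C}"
      using graph_connected_insert[OF Cc] that by blast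
    then have "good (insert x C)" using apq CV that unfolding good_def D_def by blast
    then show False using no_larger that unfolding D_def by blast
  qed
  have "D = {}"
  proof (rule ccontr)
    assume "D \<noteq> {}"
    have "\<exists>x y. {x, y} \<in> E \<and> x \<in> D \<and> y \<notin> D"
      using pqV \<open>D \<noteq> {}\<close> by (intro graph_connected_edge_leaving[OF conn]) (auto simp: D_def)
    then obtain d r where dr: "{d, r} \<in> E" "d \<in> D" "r \<notin> D" by blast
    then have r: "r = p \<or> r = q"
      using no_edge simple_graph_edgeD[OF G dr(1)] unfolding D_def by blast
    have "\<exists>x y. {x, y} \<in> E \<and> x \<in> C \<and> y \<notin> C"
      using pqV apq CV \<open>C \<noteq> {}\<close> by (intro graph_connected_edge_leaving[OF conn]) auto
    then obtain c s where cs: "{c, s} \<in> E" "c \<in> C" "s \<notin> C" by blast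
    then have "s \<notin> D" using no_edge by (metis insert_commute)
    then have s: "s = p \<or> s = q"
      using cs simple_graph_edgeD[OF G cs(1)] unfolding D_def by blast
    have "\<exists>t d c. t \<in> {p, q} \<and> d \<in> D \<and> {d, t} \<in> E \<and> c \<in> C \<and> {t, c} \<in> E"
    proof (cases "a \<in> C")
      case True
      then have "{r, a} \<in> E" using r apq by (auto simp: insert_commute)
      then show ?thesis using r dr True by blast
    next
      case False
      then have "a \<in> D" using pqV unfolding D_def by blast
      moreover have "{a, s} \<in> E" using s apq by auto
      moreover have "{s, c} \<in> E" using cs by (simp add: insert_commute)
      ultimately show ?thesis using s cs by blast
    qed
    then obtain t d c where t: "t \<in> {p, q}" "d \<in> D" "{d, t} \<in> E" "c \<in> C" "{t, c} \<in> E" by blast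
    obtain p' q' where pq': "{d, p'} \<in> E" "{d, q'} \<in> E" "p' \<noteq> q'" "p' \<noteq> t" "q' \<noteq> t"
      using two_more[of d t] t(2) unfolding D_def by blast
    then have "p' \<notin> insert t C" "q' \<notin> insert t C" using no_edge t(2) by blast+
    then have "good (insert t C)"
      using graph_connected_insert[OF Cc t(4,5)] pq' CV t(1) pqV unfolding good_def by blast
    then show False using no_larger t(1) apq by blast
  qed
  then have "C = V - {p, q}" using CV apq unfolding D_def by blast
  then show thesis using that apq Cc by blast
qed

section \<open>Deleting four edges\<close>

text \<open>
  A bipartite graph has no triangle, so two neighbours \<open>p\<close>, \<open>q\<close> of \<open>a\<close> are not adjacent. Hence
  six edges meet \<open>{p, q}\<close>, and four of them avoid \<open>a\<close>.
\<close>

lemma anti_kekule_set_of_card_4: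
  assumes G: "simple_graph V E" and conn: "graph_connected V E"
    and cub: "cubic V E" and bip: "bipartite V E"
  shows "\<exists>S. anti_kekule_set V E S \<and> card S = 4"
proof -
  obtain a p q where apq: "{a, p} \<in> E" "{a, q} \<in> E" "p \<noteq> q"
    and rest: "graph_connected (V - {p, q}) {e \<in> E. e \<subseteq> V - {p, q}}"
  proof (rule nonseparating_neighbours[OF G conn])
    show "3 \<le> degree E v" if "v \<in> V" for v using cub that unfolding cubic_def by simp
  qed
  have V: "a \<in> V" "p \<in> V" "q \<in> V" "a \<noteq> p" "a \<noteq> q"
    using simple_graph_edgeD[OF G apq(1)] simple_graph_edgeD[OF G apq(2)] by auto
  obtain A B where AB: "A \<inter> B = {}" "\<forall>e\<in>E. \<exists>a\<in>A. \<exists>b\<in>B. e = {a, b}"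
    using bip unfolding bipartite_def by blast
  have one: "x = y" if e: "e \<in> E" and x: "x \<in> e \<inter> {p, q}" and y: "y \<in> e \<inter> {p, q}" for e x y
  proof (rule ccontr)
    assume "x \<noteq> y"
    moreover have "\<exists>u w. e = {u, w}" using AB(2) e by blast
    ultimately have pq: "e = {p, q}" using x y by (auto simp: insert_commute)
    then show False
      using bipartition_edge[OF AB, of a p] bipartition_edge[OF AB, of a q]
        bipartition_edge[OF AB, of p q] apq e by blast
  qed
  define S where "S = {e \<in> E. e \<inter> {p, q} \<noteq> {}} - {{a, p}, {a, q}}"
  have "card {e \<in> E. e \<inter> {p, q} \<noteq> {}} = 3 * card {p, q}"
    using finite_edges[OF G] one V cub unfolding cubic_def
    by (intro card_edges_meeting) blast+
  then have "card S = 4"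
    using apq V unfolding S_def by (subst card_Diff_subset) (auto simp: doubleton_eq_iff)
  have a_left: "e = {a, x}" if e: "e \<in> E - S" "x \<in> e" "x \<in> {p, q}" for e x
    using that one[of e p q] apq(3) unfolding S_def by auto
  have "graph_connected V (E - S)"
  proof (rule graph_connectedI[OF V(1)])
    fix v assume v: "v \<in> V"
    show "(v, a) \<in> {(x, y). {x, y} \<in> E - S}\<^sup>*"
    proof (cases "v \<in> {p, q}")
      case True
      then have "{v, a} \<in> E - S" using apq unfolding S_def by (auto simp: insert_commute)
      then show ?thesis by auto
    next
      case False
      then have "(v, a) \<in> {(x, y). {x, y} \<in> {e \<in> E. e \<subseteq> V - {p, q}}}\<^sup>*"
        using rest v V unfolding graph_connected_def by blast
      then show ?thesis by (rule rtrancl_mono[THEN subsetD, rotated]) (auto simp: S_def)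
    qed
  qed
  moreover have False if M: "perfect_matching V (E - S) M" for M
  proof -
    obtain e e' where e: "e \<in> M" "p \<in> e" "e' \<in> M" "q \<in> e'"
      using M V unfolding perfect_matching_def by blast
    then have eq: "e = {a, p}" "e' = {a, q}"
      using M a_left unfolding perfect_matching_def by blast+
    then have "e \<noteq> e'" using apq V by (auto simp: doubleton_eq_iff)
    then have "disjnt e e'"
      using M e pairwiseD unfolding perfect_matching_def by metis
    then show False using eq by (simp add: disjnt_def)
  qed
  moreover have "S \<subseteq> E" unfolding S_def by blast
  ultimately show ?thesis using \<open>card S = 4\<close> unfolding anti_kekule_set_def by blast
qed

section \<open>The anti-Kekule number\<close>

theorem theorem1p5:
  fixes V :: "'a set" and E :: "'a set set"
  assumes "simple_graph V E"
    and "graph_connected V E"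
    and "cubic V E"
    and "bipartite V E"
  shows "anti_kekule_number V E = 4"
proof (rule antisym)
  obtain S where S: "anti_kekule_set V E S" "card S = 4"
    using anti_kekule_set_of_card_4[OF assms] by blast
  have "anti_kekule_number V E \<le> enat (card S)"
    unfolding anti_kekule_number_def using S(1) by (intro INF_lower) simp
  then show "anti_kekule_number V E \<le> 4" using S(2) by (simp add: numeral_eq_enat)
  have "\<not> card S \<le> 3" if "anti_kekule_set V E S" for S
    using perfect_matching_after_deleting_three[OF assms(1,3,4), of S] that
    unfolding anti_kekule_set_def by blast
  then have "4 \<le> card S" if "anti_kekule_set V E S" for S
    using that by fastforce
  then show "4 \<le> anti_kekule_number V E"
    unfolding anti_kekule_number_def by (intro INF_greatest) (simp add: numeral_eq_enat)
qed

end
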